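(* Let $k \in \{3,4,5\}$. Set $v_1 = k^2 - k + 1$ and $v_j = k(k-1)\prod_{i=1}^{j-1} v_i + 1$ for $j > 1$, and let $H_i(k)$ be an $S(2,k,v_i)$-system for all $i \geq 1$. Define $$S_1(k) = K_k, \qquad S_{i+1}(k) = \Gamma(S_i(k), H_i(k)) \quad (i \geq 1).$$ Then $S_t(k)$ is a connected graph of order $n_t = k\prod_{i=1}^{t-1} v_i$ and constant link $tK_{k-1}$, for any $t \geq 1$. Moreover, $S_t(3)$ is $\{C_4, C_5\}$-free, and $S_t(4)$ is $C_5$-free, for every $t \geq 1$.
   Context: All graphs are finite and simple; order means number of vertices. A graph $G$ has constant link $L$ if for every vertex $v$ the subgraph induced by the open neighborhood $N(v)$ is isomorphic to $L$; $tL$ is the disjoint union of $t$ copies of $L$. "$C_\ell$-free" means containing no cycle of length $\ell$ as a (not necessarily induced) subgraph. A Steiner system $S(2,k,v)$ is a pair $(V,B)$ where $V$ is a set of $v$ points and $B$ is a family of $k$-element subsets of $V$ (blocks) such that each $2$-element subset of $V$ is contained in exactly one block. It is regarded as a $k$-uniform $\frac{v-1}{k-1}$-regular hypergraph with vertex set $V$ and edge set $B$. (For $k\in\{3,4,5\}$ an $S(2,k,v)$ is known to exist for every $v\equiv 1 \pmod{k(k-1)}$, $v>1$.) Construction of $\Gamma(G,H)$ (with the clique $K_k$): let $G$ be a graph of order $n$ and constant link $sK_{k-1}$ for some $s\ge1$, and $H$ an $n$-regular $k$-uniform hypergraph (every vertex in exactly $n$ edges, every edge of size $k$) with vertices $x_1,\dots,x_N$.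 (1) At each vertex $x$ of $H$ enumerate the hyperedges containing $x$ as $E_{x,1},\dots,E_{x,n}$. (2) Take $N$ disjoint copies of $G$ on vertex sets $V_1,\dots,V_N$, $V_i=\{v_{i,1},\dots,v_{i,n}\}$, and set $V(\Gamma)=V_1\cup\dots\cup V_N$. (3) With each edge $E$ of $H$ associate the $k$-element set $f(E)\subseteq V(\Gamma)$ defined by $v_{i,j}\in f(E)$ if and only if $E_{x_i,j}=E$. (4) For each hyperedge $E$ of $H$, place a copy of $K_k$ on the set $f(E)$. The resulting graph (for any choice of the enumerations) is $\Gamma(G,H)$. *)

theory Defs
  imports "Graph_Theory.Graph_Theory"
begin

text \<open>
  A finite simple graph is a \<^locale>\<open>pair_graph\<close>: a finite symmetric loop-free digraph whose arcs
  are pairs of vertices, so that every edge occurs as two opposite arcs. The order of a graph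
  \<open>G\<close> is \<open>card (pverts G)\<close>.
\<close>

definition complete_on :: "'a set \<Rightarrow> 'a pair_pre_digraph" where
  "complete_on V = \<lparr>pverts = V, parcs = {(x, y). x \<in> V \<and> y \<in> V \<and> x \<noteq> y}\<rparr>"

definition copies :: "nat \<Rightarrow> 'a pair_pre_digraph \<Rightarrow> (nat \<times> 'a) pair_pre_digraph" where
  "copies t L =
    \<lparr>pverts = {..<t} \<times> pverts L,
     parcs = {((i, x), (i, y)) | i x y. i < t \<and> (x, y) \<in> parcs L}\<rparr>"

definition constant_link :: "('a, 'b) pre_digraph \<Rightarrow> ('c, 'd) pre_digraph \<Rightarrow> bool" where
  "constant_link G L \<longleftrightarrow> (\<forall>v \<in> verts G. digraph_iso (G \<restriction> {u. v \<rightarrow>\<^bsub>G\<^esub> u}) L)"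

text \<open>
  \<^const>\<open>pre_digraph.cycle\<close> also accepts the closed walk along an arc and back. For the lengths
  \<open>l \<ge> 3\<close> used below, its cycles of length \<open>l\<close> are exactly those of the undirected graph.
\<close>

definition cycle_free :: "nat \<Rightarrow> ('a, 'b) pre_digraph \<Rightarrow> bool" where
  "cycle_free l G \<longleftrightarrow> \<not> (\<exists>p. pre_digraph.cycle G p \<and> length p = l)"

record 'p hypergraph =
  points :: "'p set"
  blocks :: "'p set set"

definition steiner_system :: "nat \<Rightarrow> nat \<Rightarrow> 'p hypergraph \<Rightarrow> bool" where
  "steiner_system k v H \<longleftrightarrow>
    finite (points H) \<and> card (points H) = v \<and>
    (\<forall>E \<in> blocks H. E \<subseteq> points H \<and> card E = k) \<and>
    (\<forall>P. P \<subseteq> points H \<and> card P = 2 \<longrightarrow> (\<exists>!E. E \<in> blocks H \<and> P \<subseteq> E))"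

definition incident :: "'p hypergraph \<Rightarrow> 'p \<Rightarrow> 'p set set" where
  "incident H x = {E \<in> blocks H. x \<in> E}"

text \<open>
  In the following, \<open>n\<close> is the order of \<open>G\<close>, the pair \<open>(x, j)\<close> with \<open>1 \<le> j \<le> n\<close> is the \<open>j\<close>-th vertex
  of the copy of \<open>G\<close> belonging to the point \<open>x\<close>, \<open>lab x j\<close> is the vertex of \<open>G\<close> of which it is
  the copy, and \<open>enum x j\<close> is the \<open>j\<close>-th block through \<open>x\<close>.
\<close>

definition attach_set :: "nat \<Rightarrow> 'p hypergraph \<Rightarrow> ('p \<Rightarrow> nat \<Rightarrow> 'p set) \<Rightarrow> 'p set \<Rightarrow> ('p \<times> nat) set" where
  "attach_set n H enum E = {(x, j). x \<in> points H \<and> j \<in> {1..n} \<and> enum x j = E}"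

definition Gamma ::
  "'a pair_pre_digraph \<Rightarrow> 'p hypergraph \<Rightarrow> ('p \<Rightarrow> nat \<Rightarrow> 'a) \<Rightarrow> ('p \<Rightarrow> nat \<Rightarrow> 'p set) \<Rightarrow>
    ('p \<times> nat) pair_pre_digraph" where
  "Gamma G H lab enum =
    (let n = card (pverts G) in
      \<lparr>pverts = points H \<times> {1..n},
       parcs =
         {((x, i), (x, j)) | x i j.
            x \<in> points H \<and> i \<in> {1..n} \<and> j \<in> {1..n} \<and> (lab x i, lab x j) \<in> parcs G} \<union>
         (\<Union>E \<in> blocks H. parcs (complete_on (attach_set n H enum E)))\<rparr>)"

text \<open>
  \<open>is_Gamma G H R\<close> says that, up to isomorphism, \<open>R\<close> arises from \<open>G\<close> and \<open>H\<close> for some choice of the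
  enumerations. The blocks through \<open>x\<close> are numbered from 1 to the degree of \<open>x\<close>. That this degree
  is the order of \<open>G\<close>, as the construction requires, is not built in here; it has to be established
  wherever the construction is used.
\<close>

definition is_Gamma ::
  "'a pair_pre_digraph \<Rightarrow> 'p hypergraph \<Rightarrow> 'b pair_pre_digraph \<Rightarrow> bool" where
  "is_Gamma G H R \<longleftrightarrow>
    (\<exists>lab enum.
      (\<forall>x \<in> points H. bij_betw (lab x) {1..card (pverts G)} (pverts G)) \<and>
      (\<forall>x \<in> points H. bij_betw (enum x) {1..card (incident H x)} (incident H x)) \<and>
      digraph_iso (with_proj (Gamma G H lab enum)) (with_proj R))"

end

theory Submission
  imports Defs
begin

section \<open>Pair graphs\<close>

text \<open>The point of the construction is that the vertices of Gamma(G,H) are the flags (x, E) of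
  H, a point x on a block E. If every point lies on exactly |G| blocks, a vertex can equally be
  named by its point and its label in G. Adjacent vertices share either the point (an arc inside a
  copy of G) or the block (an arc of a block clique). Copies are pairwise disjoint, block cliques
  are pairwise disjoint, and a copy meets a block clique in at most one vertex.

  Counting the other points along the blocks through x gives degree (v-1)/(k-1)
  (\<open>steiner_system_degree\<close>). The numbers v_t are chosen so that this equals n_t, so
  each step of the recursion is legitimate and multiplies the order by v_t. Any two points lie on a
  common block, so connected copies are linked to each other (\<open>connected\<close>). The
  neighbours of a vertex are its neighbours inside the copy, inducing tK_{k-1}, and the k-1 other
  vertices of its block, with no arc between the two kinds; hence the link gains one clique
  (\<open>link_colouring\<close>).

  For short cycles, cut the cycle into maximal runs inside copies and inside blocks. The runs
  alternate, so a mixed cycle with at most five arcs has one or two runs of each kind. One of each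
  would join the same two distinct vertices through a common point and a common block; two of each
  would give two blocks with two common points. Both are impossible, so the cycle lies in a copy,
  where induction applies, or in a block clique, which has only k vertices
  (\<open>cycle_free_4\<close>, \<open>cycle_free_5\<close>).\<close>

lemma digraph_iso_with_proj_iff:
  "digraph_iso (with_proj G) (with_proj R) \<longleftrightarrow>
    pair_wf_digraph G \<and>
    (\<exists>f. inj_on f (pverts G) \<and> pverts R = f ` pverts G \<and> parcs R = map_prod f f ` parcs G)"
  (is "?iso \<longleftrightarrow> ?wf \<and> (\<exists>f. ?P f)")
proof
  assume ?iso
  then obtain h where h: "pre_digraph.digraph_isomorphism (with_proj G) h"
    and R: "with_proj R = app_iso h (with_proj G)"
    by (auto simp: digraph_iso_def)
  \<comment> \<open>The tail and head maps of \<open>app_iso h\<close> come from \<open>h\<close>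
    itself, so the equation with \<open>with_proj R\<close> forces them to be the projections; this
    is why \<open>iso_arcs h\<close> must act on arcs through the vertex map.\<close>
  have fields: "pverts R = iso_verts h ` pverts G" "parcs R = iso_arcs h ` parcs G"
    "fst = iso_tail h" "snd = iso_head h"
    using arg_cong[OF R, of verts] arg_cong[OF R, of arcs] arg_cong[OF R, of tail]
      arg_cong[OF R, of head] by simp_all
  have arc: "iso_arcs h a = map_prod (iso_verts h) (iso_verts h) a" if "a \<in> parcs G" for a
    using h that by (auto simp: pre_digraph.digraph_isomorphism_def fields[symmetric] prod_eq_iff)
  have "?P (iso_verts h)"
    using h by (auto simp: pre_digraph.digraph_isomorphism_def fields(1,2) arc cong: image_cong)
  then show "?wf \<and> (\<exists>f. ?P f)"
    using h by (auto simp: pre_digraph.digraph_isomorphism_def wf_digraph_wp_iff)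
next
  assume "?wf \<and> (\<exists>f. ?P f)"
  then obtain f where wf: ?wf and f: "?P f"
    by blast
  let ?h = "\<lparr>iso_verts = f, iso_arcs = map_prod f f, iso_head = snd, iso_tail = fst\<rparr>"
  have "inj_on (map_prod f f) (parcs G)"
    using f pair_wf_digraph.in_arcsD1[OF wf] pair_wf_digraph.in_arcsD2[OF wf]
    by (intro inj_on_subset[OF map_prod_inj_on[of f "pverts G" f "pverts G"]]) auto
  then have "pre_digraph.digraph_isomorphism (with_proj G) ?h"
    using f wf by (auto simp: pre_digraph.digraph_isomorphism_def wf_digraph_wp_iff)
  moreover have "with_proj R = app_iso ?h (with_proj G)"
    using f by (simp add: app_iso_def with_proj_def)
  ultimately show ?iso
    unfolding digraph_iso_def by blast
qed

lemma digraph_iso_with_projI: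
  assumes "pair_wf_digraph G" and bij: "bij_betw f (pverts G) (pverts R)" and "pair_wf_digraph R"
    and arcs: "\<And>u w. u \<in> pverts G \<Longrightarrow> w \<in> pverts G \<Longrightarrow> (f u, f w) \<in> parcs R \<longleftrightarrow> (u, w) \<in> parcs G"
  shows "digraph_iso (with_proj G) (with_proj R)"
proof -
  have "parcs R = map_prod f f ` parcs G"
  proof (intro set_eqI iffI)
    fix e assume e: "e \<in> parcs R"
    then have "fst e \<in> f ` pverts G" "snd e \<in> f ` pverts G"
      using bij pair_wf_digraph.arc_fst_in_verts[OF assms(3)]
        pair_wf_digraph.arc_snd_in_verts[OF assms(3)] by (auto simp: bij_betw_def)
    then obtain u w where "u \<in> pverts G" "w \<in> pverts G" "e = (f u, f w)"
      by (metis imageE prod.collapse)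
    then show "e \<in> map_prod f f ` parcs G"
      using e arcs by force
  next
    fix e assume "e \<in> map_prod f f ` parcs G"
    then show "e \<in> parcs R"
      using arcs assms(1) by (auto dest: pair_wf_digraph.wellformed')
  qed
  then have "inj_on f (pverts G) \<and> pverts R = f ` pverts G \<and> parcs R = map_prod f f ` parcs G"
    using bij by (simp add: bij_betw_def)
  then show ?thesis
    using assms(1) unfolding digraph_iso_with_proj_iff by blast
qed

lemma pair_graphI_adjacency:
  assumes "finite (pverts G)" "parcs G \<subseteq> pverts G \<times> pverts G" "irrefl (parcs G)" "sym (parcs G)"
  shows "pair_graph G"
proof -
  have "finite (parcs G)"
    by (rule finite_subset[OF assms(2)]) (simp add: assms(1))
  moreover have "fst e \<in> pverts G" "snd e \<in> pverts G" "fst e \<noteq> snd e" if "e \<in> parcs G" for e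
    using that assms(2,3) unfolding irrefl_def by (metis mem_Times_iff prod.collapse subsetD)+
  moreover have "symmetric (with_proj G)"
    using assms(4) by (simp add: symmetric_def)
  ultimately show ?thesis
    using assms(1) by unfold_locales
qed

text \<open>\<open>connected\<close> refers to the symmetric closure, which changes nothing for
  symmetric arcs; what remains is reachability in the arc relation.\<close>

lemma (in pair_graph) connected_iff:
  "connected (with_proj G) \<longleftrightarrow>
    pverts G \<noteq> {} \<and> (\<forall>u \<in> pverts G. \<forall>w \<in> pverts G. (u, w) \<in> (parcs G)\<^sup>*)"
proof -
  have "symcl (parcs G) = parcs G"
    using arcs_symmetric unfolding symcl_def by fastforce
  then have "connected (with_proj G) \<longleftrightarrow>
    pverts G \<noteq> {} \<and> (\<forall>u \<in> pverts G. \<forall>w \<in> pverts G. reachable (with_proj G) u w)"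
    by (simp add: connected_conv reachable_def)
  then show ?thesis
    by (simp add: reachable_conv')
qed

section \<open>Cycles of length 4 and 5 as tuples of vertices\<close>

text \<open>A \<open>cycle\<close> is a list of arcs; the tails of these arcs are the vertices of
  the cycle in order. The vertex form suits the case analysis on runs.\<close>

lemma (in pair_wf_digraph) cycle_free_4_iff:
  "cycle_free 4 (with_proj G) \<longleftrightarrow>
    \<not> (\<exists>a b c d. distinct [a, b, c, d] \<and> {(a, b), (b, c), (c, d), (d, a)} \<subseteq> parcs G)"
  (is "_ \<longleftrightarrow> \<not> ?C")
proof -
  have "?C" if "cycle p" "length p = 4" for p
  proof -
    obtain e f g h where p: "p = [e, f, g, h]"
      using \<open>length p = 4\<close> by (auto simp: numeral_eq_Suc length_Suc_conv)
    have "distinct [fst e, fst f, fst g, fst h] \<and>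
      {(fst e, fst f), (fst f, fst g), (fst g, fst h), (fst h, fst e)} \<subseteq> parcs G"
      using \<open>cycle p\<close>
      by (cases e; cases f; cases g; cases h) (auto simp: cycle_def awalk_def p)
    then show ?C
      by (intro exI)
  qed
  moreover have "\<exists>p. cycle p \<and> length p = 4" if C: ?C
  proof -
    obtain a b c d where "distinct [a, b, c, d]" "{(a, b), (b, c), (c, d), (d, a)} \<subseteq> parcs G"
      using C by (elim exE conjE) (rule that)
    then have "cycle [(a, b), (b, c), (c, d), (d, a)]"
      by (auto simp: cycle_def awalk_def dest: in_arcsD1)
    then show ?thesis
      by fastforce
  qed
  ultimately show ?thesis
    unfolding cycle_free_def by blast
qed

lemma (in pair_wf_digraph) cycle_free_5_iff:
  "cycle_free 5 (with_proj G) \<longleftrightarrow>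
    \<not> (\<exists>a b c d e. distinct [a, b, c, d, e] \<and>
        {(a, b), (b, c), (c, d), (d, e), (e, a)} \<subseteq> parcs G)"
  (is "_ \<longleftrightarrow> \<not> ?C")
proof -
  have "?C" if "cycle p" "length p = 5" for p
  proof -
    obtain e f g h i where p: "p = [e, f, g, h, i]"
      using \<open>length p = 5\<close> by (auto simp: numeral_eq_Suc length_Suc_conv)
    have "distinct [fst e, fst f, fst g, fst h, fst i] \<and>
      {(fst e, fst f), (fst f, fst g), (fst g, fst h), (fst h, fst i), (fst i, fst e)} \<subseteq> parcs G"
      using \<open>cycle p\<close>
      by (cases e; cases f; cases g; cases h; cases i) (auto simp: cycle_def awalk_def p)
    then show ?C
      by (intro exI)
  qed
  moreover have "\<exists>p. cycle p \<and> length p = 5" if C: ?C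
  proof -
    obtain a b c d e where "distinct [a, b, c, d, e]"
      "{(a, b), (b, c), (c, d), (d, e), (e, a)} \<subseteq> parcs G"
      using C by (elim exE conjE) (rule that)
    then have "cycle [(a, b), (b, c), (c, d), (d, e), (e, a)]"
      by (auto simp: cycle_def awalk_def dest: in_arcsD1)
    then show ?thesis
      by fastforce
  qed
  ultimately show ?thesis
    unfolding cycle_free_def by blast
qed

text \<open>A cycle needs as many vertices as its length; this is the base case of the
  induction.\<close>

lemma cycle_free_complete:
  assumes "K\<^bsub>k\<^esub> (with_proj G)"
  shows "k < 4 \<Longrightarrow> cycle_free 4 (with_proj G)" "k < 5 \<Longrightarrow> cycle_free 5 (with_proj G)"
proof -
  interpret pair_graph G
    using assms by (rule pair_graphI_complete)
  have G: "finite (pverts G)" "card (pverts G) = k"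
    using assms by (simp_all add: complete_digraph_pair_def)
  have bound: "length xs \<le> k" if "distinct xs" "set xs \<subseteq> pverts G" for xs
    using card_mono[OF G(1) that(2)] distinct_card[OF that(1)] G(2) by simp
  show "cycle_free 4 (with_proj G)" if "k < 4"
    unfolding cycle_free_4_iff
  proof safe
    fix a b c d assume "distinct [a, b, c, d]" "{(a, b), (b, c), (c, d), (d, a)} \<subseteq> parcs G"
    then show False
      using bound[of "[a, b, c, d]"] that by (auto dest: in_arcsD1)
  qed
  show "cycle_free 5 (with_proj G)" if "k < 5"
    unfolding cycle_free_5_iff
  proof safe
    fix a b c d e assume "distinct [a, b, c, d, e]"
      "{(a, b), (b, c), (c, d), (d, e), (e, a)} \<subseteq> parcs G"
    then show False
      using bound[of "[a, b, c, d, e]"] that by (auto dest: in_arcsD1)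
  qed
qed

section \<open>Links as coloured neighbourhoods\<close>

text \<open>A witness that \<open>N\<close> induces t disjoint copies of K_m, the colour being the
  number of the copy. In this form the induction step only has to add one colour, and no
  isomorphisms need to be composed.\<close>

definition clique_colouring :: "'a pair_pre_digraph \<Rightarrow> 'a set \<Rightarrow> nat \<Rightarrow> nat \<Rightarrow> ('a \<Rightarrow> nat) \<Rightarrow> bool" where
  "clique_colouring G N t m c \<longleftrightarrow>
    c ` N \<subseteq> {..<t} \<and> (\<forall>i < t. card {u \<in> N. c u = i} = m) \<and>
    (\<forall>u \<in> N. \<forall>w \<in> N. (u, w) \<in> parcs G \<longleftrightarrow> u \<noteq> w \<and> c u = c w)"

lemma (in pair_graph) constant_link_copiesI:
  assumes "m > 0"
    and col: "\<And>v. v \<in> pverts G \<Longrightarrow> \<exists>c. clique_colouring G {u. (v, u) \<in> parcs G} t m c"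
  shows "constant_link (with_proj G) (with_proj (copies t (complete_on {..<m})))"
  unfolding constant_link_def
proof
  fix v assume "v \<in> verts (with_proj G)"
  then have v: "v \<in> pverts G"
    by simp
  define N where "N = {u. (v, u) \<in> parcs G}"
  \<comment> \<open>\<open>L\<close> is the subgraph induced on the neighbourhood, written as a pair
    graph so that \<open>digraph_iso_with_projI\<close> applies.\<close>
  define L where "L = \<lparr>pverts = N, parcs = {e \<in> parcs G. fst e \<in> N \<and> snd e \<in> N}\<rparr>"
  obtain c where "clique_colouring G N t m c"
    using col[OF v] unfolding N_def by blast
  then have c: "c ` N \<subseteq> {..<t}" "\<forall>i < t. card {u \<in> N. c u = i} = m"
    and adj: "\<forall>u \<in> N. \<forall>w \<in> N. (u, w) \<in> parcs G \<longleftrightarrow> u \<noteq> w \<and> c u = c w"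
    unfolding clique_colouring_def by blast+
  \<comment> \<open>Finiteness of the colour class comes from its cardinality \<open>m\<close> being
    positive.\<close>
  have "\<exists>g. bij_betw g {u \<in> N. c u = i} {..<m}" if "i < t" for i
    using c(2) that \<open>m > 0\<close> by (metis card_gt_0_iff card_lessThan finite_lessThan finite_same_card_bij)
  then obtain g where g: "\<And>i. i < t \<Longrightarrow> bij_betw (g i) {u \<in> N. c u = i} {..<m}"
    by metis
  define f where "f u = (c u, g (c u) u)" for u
  have "inj_on f N"
    unfolding f_def
  proof (rule inj_onI)
    fix u w assume u: "u \<in> N" "w \<in> N" "(c u, g (c u) u) = (c w, g (c w) w)"
    then show "u = w"
      using g[of "c u"] c(1) by (auto simp: bij_betw_def inj_on_def)
  qed
  moreover have "f ` N = {..<t} \<times> {..<m}"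
  proof (intro set_eqI iffI)
    fix q assume "q \<in> f ` N"
    then obtain u where u: "u \<in> N" "q = f u"
      by blast
    then have "c u < t"
      using c(1) by auto
    then show "q \<in> {..<t} \<times> {..<m}"
      using u bij_betwE[OF g] by (simp add: f_def)
  next
    fix q assume q: "q \<in> {..<t} \<times> {..<m}"
    then have "snd q \<in> g (fst q) ` {u \<in> N. c u = fst q}"
      using g[of "fst q"] by (auto simp: bij_betw_def)
    then obtain u where "u \<in> N" "q = f u"
      by (auto simp: f_def prod_eq_iff)
    then show "q \<in> f ` N"
      by blast
  qed
  ultimately have bij: "bij_betw f N (pverts (copies t (complete_on {..<m})))"
    by (simp add: bij_betw_def copies_def complete_on_def)
  have "digraph_iso (with_proj L) (with_proj (copies t (complete_on {..<m})))"
  proof (rule digraph_iso_with_projI)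
    show "pair_wf_digraph L" "pair_wf_digraph (copies t (complete_on {..<m}))"
      by (auto simp: pair_wf_digraph_def L_def copies_def complete_on_def)
    show "bij_betw f (pverts L) (pverts (copies t (complete_on {..<m})))"
      using bij by (simp add: L_def)
    fix u w assume "u \<in> pverts L" "w \<in> pverts L"
    then have uw: "u \<in> N" "w \<in> N"
      by (simp_all add: L_def)
    then have "f u \<in> {..<t} \<times> {..<m}" "f w \<in> {..<t} \<times> {..<m}"
      using \<open>f ` N = _\<close> by blast+
    then show "(f u, f w) \<in> parcs (copies t (complete_on {..<m})) \<longleftrightarrow> (u, w) \<in> parcs L"
      using adj uw inj_onD[OF \<open>inj_on f N\<close> _ uw]
      by (auto simp: L_def copies_def complete_on_def f_def)
  qed
  moreover have "with_proj G \<restriction> N = with_proj L"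
    by (simp add: induce_subgraph_def with_proj_def L_def)
  ultimately show "digraph_iso (with_proj G \<restriction> {u. v \<rightarrow>\<^bsub>with_proj G\<^esub> u})
      (with_proj (copies t (complete_on {..<m})))"
    by (simp add: N_def)
qed

section \<open>Steiner systems\<close>

lemma steiner_system_finite_blocks:
  assumes "steiner_system k v H"
  shows "finite (blocks H)"
  using assms by (auto simp: steiner_system_def intro: finite_subset[of _ "Pow (points H)"])

lemma steiner_system_block:
  assumes "steiner_system k v H" "x \<in> points H" "y \<in> points H" "x \<noteq> y"
  shows "\<exists>!E. E \<in> blocks H \<and> x \<in> E \<and> y \<in> E"
proof -
  have "\<forall>P. P \<subseteq> points H \<and> card P = 2 \<longrightarrow> (\<exists>!E. E \<in> blocks H \<and> P \<subseteq> E)"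
    using assms(1) unfolding steiner_system_def by (elim conjE)
  from spec[OF this, of "{x, y}"] show ?thesis
    using assms(2-4) by simp
qed

lemma steiner_system_block_unique:
  assumes H: "steiner_system k v H" and "E \<in> blocks H" "F \<in> blocks H"
    and "x \<in> E" "x \<in> F" "y \<in> E" "y \<in> F" "x \<noteq> y"
  shows "E = F"
proof -
  have "x \<in> points H" "y \<in> points H"
    using assms unfolding steiner_system_def by blast+
  then show ?thesis
    using steiner_system_block[OF H, of x y] assms by blast
qed

text \<open>The blocks through \<open>x\<close>, with \<open>x\<close> removed, partition the
  remaining points into sets of size \<open>k - 1\<close>. The product form avoids a
  division.\<close>

lemma steiner_system_degree:
  assumes H: "steiner_system k v H" and x: "x \<in> points H" and "k > 0"
  shows "card (incident H x) * (k - 1) = v - 1"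
proof -
  have blk: "E \<subseteq> points H" "card E = k" "finite E" if "E \<in> blocks H" for E
    using H that \<open>k > 0\<close> by (auto simp: steiner_system_def intro: card_ge_0_finite)
  have fin: "finite (points H)" "card (points H) = v"
    using H by (auto simp: steiner_system_def)
  have "points H - {x} = (\<Union>E \<in> incident H x. E - {x})"
  proof (intro set_eqI iffI)
    fix y assume "y \<in> points H - {x}"
    then show "y \<in> (\<Union>E \<in> incident H x. E - {x})"
      using steiner_system_block[OF H x, of y] by (auto simp: incident_def)
  qed (use blk in \<open>auto simp: incident_def\<close>)
  then have "card (points H - {x}) = card (\<Union>E \<in> incident H x. E - {x})"
    by simp
  also have "\<dots> = (\<Sum>E \<in> incident H x. card (E - {x}))"
  proof (rule card_UN_disjoint)
    show "finite (incident H x)"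
      using steiner_system_finite_blocks[OF H] by (simp add: incident_def)
    show "\<forall>E \<in> incident H x. finite (E - {x})"
      using blk by (auto simp: incident_def)
    show "\<forall>E \<in> incident H x. \<forall>F \<in> incident H x. E \<noteq> F \<longrightarrow> (E - {x}) \<inter> (F - {x}) = {}"
      using steiner_system_block_unique[OF H] unfolding incident_def by blast
  qed
  also have "\<dots> = (\<Sum>E \<in> incident H x. k - 1)"
    using blk by (intro sum.cong) (auto simp: incident_def)
  finally show ?thesis
    using fin x by simp
qed

section \<open>The construction\<close>

text \<open>
  The construction needs no enumerations: a vertex \<open>u\<close> of \<open>\<Gamma>(G, H)\<close> is determined by its point
  \<open>pt u\<close> together with either its label \<open>lb u\<close> in \<open>G\<close> or its block \<open>bl u\<close>. So the vertices are the
  flags of \<open>H\<close>.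
\<close>

locale gamma_graph =
  fixes G :: "'a pair_pre_digraph" and H :: "'p hypergraph" and R :: "'b pair_pre_digraph"
    and k v :: nat and pt :: "'b \<Rightarrow> 'p" and lb :: "'b \<Rightarrow> 'a" and bl :: "'b \<Rightarrow> 'p set"
  assumes G: "pair_graph G"
    and H: "steiner_system k v H"
    and k: "k \<ge> 2"
    and lab: "bij_betw (\<lambda>u. (pt u, lb u)) (pverts R) (points H \<times> pverts G)"
    and flag: "bij_betw (\<lambda>u. (pt u, bl u)) (pverts R) {(x, E). E \<in> blocks H \<and> x \<in> E}"
    and adj: "parcs R = {(u, w). u \<in> pverts R \<and> w \<in> pverts R \<and>
      (pt u = pt w \<and> (lb u, lb w) \<in> parcs G \<or> pt u \<noteq> pt w \<and> bl u = bl w)}"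

section \<open>From enumerations to flags\<close>

lemma bij_betw_Sigma:
  assumes "\<And>x. x \<in> P \<Longrightarrow> bij_betw (h x) (A x) (B x)"
  shows "bij_betw (\<lambda>(x, i). (x, h x i)) (Sigma P A) (Sigma P B)"
proof (rule bij_betw_imageI)
  show "inj_on (\<lambda>(x, i). (x, h x i)) (Sigma P A)"
    using inj_onD[OF bij_betw_imp_inj_on[OF assms]] by (auto intro!: inj_onI)
  have "(\<lambda>(x, i). (x, h x i)) ` Sigma P A = (SIGMA x:P. h x ` A x)"
    by auto
  also have "\<dots> = Sigma P B"
    by (intro Sigma_cong refl bij_betw_imp_surj_on[OF assms])
  finally show "(\<lambda>(x, i). (x, h x i)) ` Sigma P A = Sigma P B" .
qed

text \<open>Since the degree of each point is the order of \<open>G\<close>, one index range numbers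
  both the vertices of a copy and the blocks through its point. Both namings are then carried to
  \<open>R\<close> by the inverse of the isomorphism.\<close>

lemma is_Gamma_imp_gamma_graph:
  assumes "pair_graph G" and H: "steiner_system k v H" and "k \<ge> 2"
    and n: "\<And>x. x \<in> points H \<Longrightarrow> card (incident H x) = card (pverts G)"
    and R: "is_Gamma G H R"
  shows "\<exists>pt lb bl. gamma_graph G H R k v pt lb bl"
proof -
  define n where "n = card (pverts G)"
  obtain lab enum where "\<forall>x \<in> points H. bij_betw (lab x) {1..n} (pverts G)"
    and "\<forall>x \<in> points H. bij_betw (enum x) {1..card (incident H x)} (incident H x)"
    and iso: "digraph_iso (with_proj (Gamma G H lab enum)) (with_proj R)"
    using R unfolding is_Gamma_def n_def[symmetric] by blast
  then have lab: "\<And>x. x \<in> points H \<Longrightarrow> bij_betw (lab x) {1..n} (pverts G)"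
    and enum: "\<And>x. x \<in> points H \<Longrightarrow> bij_betw (enum x) {1..n} (incident H x)"
    using n by (simp_all add: n_def)
  define V where "V = points H \<times> {1..n}"
  \<comment> \<open>Requiring different points in the second clause loses no clique arc: within one
    copy different indices name different blocks.\<close>
  define A where "A q r \<longleftrightarrow>
      (fst q = fst r \<and> (lab (fst q) (snd q), lab (fst r) (snd r)) \<in> parcs G \<or>
       fst q \<noteq> fst r \<and> enum (fst q) (snd q) = enum (fst r) (snd r))" for q r
  have V: "pverts (Gamma G H lab enum) = V"
    by (simp add: Gamma_def V_def n_def Let_def)
  have inj: "enum x i = enum x j \<longleftrightarrow> i = j" if "x \<in> points H" "i \<in> {1..n}" "j \<in> {1..n}" for x i j
    using that(2,3) by (rule inj_on_eq_iff[OF bij_betw_imp_inj_on[OF enum[OF that(1)]]])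
  have mem: "enum x i \<in> blocks H" "x \<in> enum x i" if "x \<in> points H" "i \<in> {1..n}" for x i
    using bij_betwE[OF enum[OF that(1)]] that(2) by (auto simp: incident_def)
  have arcs: "parcs (Gamma G H lab enum) = {(q, r). q \<in> V \<and> r \<in> V \<and> A q r}"
  proof (intro set_eqI iffI)
    fix e assume "e \<in> parcs (Gamma G H lab enum)"
    then show "e \<in> {(q, r). q \<in> V \<and> r \<in> V \<and> A q r}"
      using inj
      by (auto simp: Gamma_def Let_def n_def[symmetric] V_def A_def complete_on_def attach_set_def)
  next
    fix e assume "e \<in> {(q, r). q \<in> V \<and> r \<in> V \<and> A q r}"
    then obtain x i y j where e: "e = ((x, i), (y, j))" "x \<in> points H" "y \<in> points H"
      "i \<in> {1..n}" "j \<in> {1..n}" "A (x, i) (y, j)"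
      by (auto simp: V_def)
    then show "e \<in> parcs (Gamma G H lab enum)"
      using mem[of x i]
      by (auto simp: Gamma_def Let_def n_def[symmetric] A_def complete_on_def attach_set_def)
  qed
  obtain f where f: "inj_on f V" "pverts R = f ` V"
    and fR: "parcs R = map_prod f f ` {(q, r). q \<in> V \<and> r \<in> V \<and> A q r}"
    using iso by (auto simp: digraph_iso_with_proj_iff V arcs)
  define g where "g = the_inv_into V f"
  have gf: "g (f q) = q" if "q \<in> V" for q
    using f(1) that by (simp add: g_def the_inv_into_f_f)
  have bij: "bij_betw g (pverts R) V"
    using f unfolding g_def by (simp add: bij_betw_the_inv_into inj_on_imp_bij_betw)
  define pt lb bl where "pt u = fst (g u)" and "lb u = lab (fst (g u)) (snd (g u))"
    and "bl u = enum (fst (g u)) (snd (g u))" for u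
  have pts: "E \<subseteq> points H" if "E \<in> blocks H" for E
    using H that by (simp add: steiner_system_def)
  have "bij_betw (\<lambda>(x, i). (x, lab x i)) V (points H \<times> pverts G)"
    unfolding V_def using lab by (rule bij_betw_Sigma)
  then have "bij_betw ((\<lambda>(x, i). (x, lab x i)) \<circ> g) (pverts R) (points H \<times> pverts G)"
    using bij bij_betw_trans by blast
  moreover have "Sigma (points H) (incident H) = {(x, E). E \<in> blocks H \<and> x \<in> E}"
    using pts by (auto simp: incident_def)
  then have "bij_betw (\<lambda>(x, i). (x, enum x i)) V {(x, E). E \<in> blocks H \<and> x \<in> E}"
    using bij_betw_Sigma[of "points H" enum "\<lambda>_. {1..n}" "incident H", OF enum]
    unfolding V_def by simp
  then have "bij_betw ((\<lambda>(x, i). (x, enum x i)) \<circ> g) (pverts R) {(x, E). E \<in> blocks H \<and> x \<in> E}"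
    using bij bij_betw_trans by blast
  moreover have "parcs R = {(u, w). u \<in> pverts R \<and> w \<in> pverts R \<and>
      (pt u = pt w \<and> (lb u, lb w) \<in> parcs G \<or> pt u \<noteq> pt w \<and> bl u = bl w)}"
    by (auto simp: fR f(2) gf A_def pt_def lb_def bl_def)
  ultimately have "gamma_graph G H R k v pt lb bl"
    using assms(1-3) by (simp add: gamma_graph_def pt_def lb_def bl_def comp_def case_prod_beta)
  then show ?thesis
    by blast
qed

section \<open>Coordinates of vertices, and the order\<close>

context gamma_graph
begin

interpretation G: pair_graph G
  by (rule G)

lemma block_card: "E \<in> blocks H \<Longrightarrow> card E = k"
  using H by (simp add: steiner_system_def)

lemma pt_in: "u \<in> pverts R \<Longrightarrow> pt u \<in> points H"
  and lb_in: "u \<in> pverts R \<Longrightarrow> lb u \<in> pverts G"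
  using bij_betwE[OF lab] by auto

lemma bl_in: "u \<in> pverts R \<Longrightarrow> bl u \<in> blocks H" "u \<in> pverts R \<Longrightarrow> pt u \<in> bl u"
  using bij_betwE[OF flag] by auto

lemma lab_eq: "\<lbrakk>u \<in> pverts R; w \<in> pverts R; pt u = pt w; lb u = lb w\<rbrakk> \<Longrightarrow> u = w"
  using lab by (simp add: bij_betw_def inj_on_def)

lemma flag_eq: "\<lbrakk>u \<in> pverts R; w \<in> pverts R; pt u = pt w; bl u = bl w\<rbrakk> \<Longrightarrow> u = w"
  using flag by (simp add: bij_betw_def inj_on_def)

lemma lab_obtain:
  assumes "x \<in> points H" "a \<in> pverts G"
  obtains u where "u \<in> pverts R" "pt u = x" "lb u = a"
proof -
  have "(x, a) \<in> (\<lambda>u. (pt u, lb u)) ` pverts R"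
    using lab assms by (simp add: bij_betw_def)
  then show ?thesis
    using that by auto
qed

lemma flag_obtain:
  assumes "E \<in> blocks H" "x \<in> E"
  obtains u where "u \<in> pverts R" "pt u = x" "bl u = E"
proof -
  have "(x, E) \<in> (\<lambda>u. (pt u, bl u)) ` pverts R"
    using flag assms by (simp add: bij_betw_def)
  then show ?thesis
    using that by auto
qed

text \<open>Two blocks running between the same two copies have two points in common and so
  coincide; then \<open>u\<close> and \<open>u'\<close> are the same flag. This excludes cycles with
  two crossings.\<close>

lemma two_points:
  assumes "u \<in> pverts R" "w \<in> pverts R" "u' \<in> pverts R" "w' \<in> pverts R"
    and "pt u = pt u'" "pt w = pt w'" "bl u = bl w" "bl u' = bl w'" "u \<noteq> w"
  shows "u = u'"
proof -
  have "pt u \<noteq> pt w"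
    using assms flag_eq by blast
  then have "bl u = bl u'"
    using steiner_system_block_unique[OF H, of "bl u" "bl u'" "pt u" "pt w"] assms bl_in by metis
  then show ?thesis
    using flag_eq assms by blast
qed

lemma card_pverts: "card (pverts R) = v * card (pverts G)"
  using bij_betw_same_card[OF lab] H by (simp add: card_cartesian_product steiner_system_def)

lemma finite_pverts: "finite (pverts R)"
  using bij_betw_finite[OF lab] H G.pair_finite_verts by (simp add: steiner_system_def)

lemma pair_graph: "pair_graph R"
proof (rule pair_graphI_adjacency)
  show "sym (parcs R)"
    using G.arcs_symmetric unfolding adj sym_def by auto
qed (use finite_pverts in \<open>auto simp: adj irrefl_def dest: G.no_loops'\<close>)

interpretation R: pair_graph R
  by (rule pair_graph)

section \<open>Connectedness\<close>

lemma copy_reachable: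
  assumes "(a, b) \<in> (parcs G)\<^sup>*" "u \<in> pverts R" "w \<in> pverts R" "pt u = pt w" "lb u = a" "lb w = b"
  shows "(u, w) \<in> (parcs R)\<^sup>*"
  using assms
proof (induction arbitrary: w)
  case base
  then show ?case
    using lab_eq[of u w] by simp
next
  case (step b c)
  then obtain w' where w': "w' \<in> pverts R" "pt w' = pt w" "lb w' = b"
    using lab_obtain[of "pt w" b] pt_in G.in_arcsD1 by metis
  then have "(w', w) \<in> parcs R"
    using step by (simp add: adj)
  then show ?case
    using step w' by (metis rtrancl.rtrancl_into_rtrancl)
qed

text \<open>To get from one copy to another, walk inside the first to its vertex on the block
  joining the two points, cross that block, and walk inside the second. Positivity of
  \<open>v\<close> makes the vertex set nonempty.\<close>

lemma connected:
  assumes "connected (with_proj G)" "v > 0"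
  shows "connected (with_proj R)"
proof -
  have conn: "(a, b) \<in> (parcs G)\<^sup>*" if "a \<in> pverts G" "b \<in> pverts G" for a b
    using assms(1) that by (simp add: G.connected_iff)
  have copy: "(u, w) \<in> (parcs R)\<^sup>*" if "u \<in> pverts R" "w \<in> pverts R" "pt u = pt w" for u w
    using copy_reachable[OF conn that] that lb_in by blast
  have "(u, w) \<in> (parcs R)\<^sup>*" if uw: "u \<in> pverts R" "w \<in> pverts R" "pt u \<noteq> pt w" for u w
  proof -
    obtain E where E: "E \<in> blocks H" "pt u \<in> E" "pt w \<in> E"
      using steiner_system_block[OF H, of "pt u" "pt w"] pt_in uw by blast
    obtain u' where u': "u' \<in> pverts R" "pt u' = pt u" "bl u' = E"
      using flag_obtain E by blast
    obtain w' where w': "w' \<in> pverts R" "pt w' = pt w" "bl w' = E"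
      using flag_obtain E by blast
    have "(u', w') \<in> parcs R"
      using u' w' uw by (simp add: adj)
    moreover have "(u, u') \<in> (parcs R)\<^sup>*" "(w', w) \<in> (parcs R)\<^sup>*"
      using copy u' w' uw by auto
    ultimately show ?thesis
      by (meson rtrancl.rtrancl_into_rtrancl rtrancl_trans)
  qed
  moreover have "pverts R \<noteq> {}"
  proof -
    obtain x a where "x \<in> points H" "a \<in> pverts G"
      using assms H by (fastforce simp: G.connected_iff steiner_system_def)
    then show ?thesis
      using lab_obtain by blast
  qed
  ultimately show ?thesis
    using copy unfolding R.connected_iff by blast
qed

section \<open>Links\<close>

lemma card_other_flags:
  assumes "u \<in> pverts R"
  shows "card {w \<in> pverts R. pt w \<noteq> pt u \<and> bl w = bl u} = k - 1"
proof -
  let ?W = "{w \<in> pverts R. pt w \<noteq> pt u \<and> bl w = bl u}"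
  have "bij_betw pt ?W (bl u - {pt u})"
  proof (rule bij_betw_imageI)
    show "inj_on pt ?W"
      using flag_eq by (auto simp: inj_on_def)
    show "pt ` ?W = bl u - {pt u}"
    proof (intro set_eqI iffI)
      fix x assume "x \<in> bl u - {pt u}"
      moreover then obtain w where "w \<in> pverts R" "pt w = x" "bl w = bl u"
        using flag_obtain[of "bl u" x] bl_in assms by blast
      ultimately show "x \<in> pt ` ?W"
        by auto
    qed (use bl_in in auto)
  qed
  then have "card ?W = card (bl u - {pt u})"
    by (rule bij_betw_same_card)
  then show ?thesis
    using assms bl_in block_card by simp
qed

lemma link_colouring:
  assumes u: "u \<in> pverts R" and c: "clique_colouring G {a. (lb u, a) \<in> parcs G} t (k - 1) c"
  shows "\<exists>c'. clique_colouring R {w. (u, w) \<in> parcs R} (Suc t) (k - 1) c'"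
proof -
  define N where "N = {a. (lb u, a) \<in> parcs G}"
  define I where "I = {w \<in> pverts R. pt w = pt u \<and> lb w \<in> N}"
  define J where "J = {w \<in> pverts R. pt w \<noteq> pt u \<and> bl w = bl u}"
  \<comment> \<open>The old colours are below \<open>t\<close>, so \<open>t\<close> is free for the
    new clique formed by the block of \<open>u\<close>.\<close>
  define c' where "c' w = (if pt w = pt u then c (lb w) else t)" for w
  have nbrs: "{w. (u, w) \<in> parcs R} = I \<union> J"
    using u by (auto simp: adj I_def J_def N_def)
  have c_lt: "c a < t" if "a \<in> N" for a
    using c that by (auto simp: clique_colouring_def N_def)
  have I_lt: "c' w < t" if "w \<in> I" for w
    using that c_lt by (simp add: c'_def I_def)
  have J_eq: "c' w = t" if "w \<in> J" for w
    using that by (simp add: c'_def J_def)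
  have bij: "bij_betw lb {w \<in> I \<union> J. c' w = i} {a \<in> N. c a = i}" if "i < t" for i
  proof (rule bij_betw_imageI)
    show "inj_on lb {w \<in> I \<union> J. c' w = i}"
      using that lab_eq J_eq by (auto simp: inj_on_def I_def)
    show "lb ` {w \<in> I \<union> J. c' w = i} = {a \<in> N. c a = i}"
    proof (intro set_eqI iffI)
      fix a assume a: "a \<in> {a \<in> N. c a = i}"
      then have "a \<in> pverts G"
        by (auto simp: N_def dest: G.in_arcsD2)
      then obtain w where "w \<in> pverts R" "pt w = pt u" "lb w = a"
        using lab_obtain pt_in u by metis
      then show "a \<in> lb ` {w \<in> I \<union> J. c' w = i}"
        using a by (auto simp: I_def c'_def intro!: image_eqI[of _ _ w])
    qed (use that in \<open>auto simp: I_def J_def c'_def\<close>)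
  qed
  have card: "card {w \<in> I \<union> J. c' w = i} = k - 1" if "i < Suc t" for i
  proof (cases "i = t")
    case True
    then have "{w \<in> I \<union> J. c' w = i} = J"
      using I_lt J_eq by fastforce
    then show ?thesis
      using card_other_flags[OF u] by (simp add: J_def)
  next
    case False
    then show ?thesis
      using bij_betw_same_card[OF bij[of i]] that c by (simp add: clique_colouring_def N_def)
  qed
  have II: "(w, z) \<in> parcs R \<longleftrightarrow> w \<noteq> z \<and> c' w = c' z" if "w \<in> I" "z \<in> I" for w z
    using that c lab_eq[of w z] unfolding clique_colouring_def N_def[symmetric]
    by (auto simp: adj I_def c'_def)
  have JJ: "(w, z) \<in> parcs R \<longleftrightarrow> w \<noteq> z \<and> c' w = c' z" if "w \<in> J" "z \<in> J" for w z
    using that flag_eq[of w z] G.no_loops' lab_eq[of w z]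
    by (auto simp: adj J_def c'_def)
  \<comment> \<open>The two vertices have different points, so an arc would put \<open>w\<close> on
    the block of \<open>u\<close>; then \<open>w\<close> and \<open>u\<close> are the same flag,
    although \<open>w\<close> is a neighbour of \<open>u\<close>.\<close>
  have IJ: "(w, z) \<notin> parcs R" if "w \<in> I" "z \<in> J" for w z
  proof
    assume "(w, z) \<in> parcs R"
    then have "pt w = pt z \<or> bl w = bl z"
      unfolding adj by blast
    then have "bl w = bl u"
      using that unfolding I_def J_def by fastforce
    then have "w = u"
      using that(1) u flag_eq unfolding I_def by blast
    then show False
      using that by (auto simp: I_def N_def dest: G.no_loops')
  qed
  have "(w, z) \<in> parcs R \<longleftrightarrow> w \<noteq> z \<and> c' w = c' z" if "w \<in> I \<union> J" "z \<in> I \<union> J" for w z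
    using that II JJ IJ I_lt J_eq R.arcs_symmetric by (metis UnE less_irrefl)
  moreover have "c' ` (I \<union> J) \<subseteq> {..<Suc t}"
    using I_lt J_eq by (fastforce simp: less_Suc_eq)
  ultimately have "clique_colouring R (I \<union> J) (Suc t) (k - 1) c'"
    using card by (simp add: clique_colouring_def)
  then show ?thesis
    unfolding nbrs by blast
qed

section \<open>Short cycles\<close>

lemma arc_cases:
  assumes "(u, w) \<in> parcs R"
  shows "u \<in> pverts R" "w \<in> pverts R" "pt u = pt w \<or> bl u = bl w"
    "pt u = pt w \<Longrightarrow> (lb u, lb w) \<in> parcs G"
  using assms by (auto simp: adj)

text \<open>Different vertices of one block clique have different points, all of them in the
  block.\<close>

lemma length_same_block:
  assumes "distinct us" "us \<noteq> []" "set us \<subseteq> pverts R" "\<And>u. u \<in> set us \<Longrightarrow> bl u = E"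
  shows "length us \<le> k"
proof -
  have E: "E \<in> blocks H"
    using assms bl_in by (metis hd_in_set subsetD)
  have "inj_on pt (set us)"
    using assms flag_eq by (intro inj_onI) (metis subsetD)
  then have "length us = card (pt ` set us)"
    using assms(1) by (simp add: card_image distinct_card)
  also have "\<dots> \<le> card E"
  proof (rule card_mono)
    show "finite E"
      using block_card[OF E] k by (intro card_ge_0_finite) simp
    show "pt ` set us \<subseteq> E"
      using assms(3,4) bl_in(2) by blast
  qed
  finally show ?thesis
    using E block_card by simp
qed

text \<open>
  A cycle of length at most 5 that is confined neither to one copy of \<open>G\<close> nor to one block crosses
  between copies along at most two blocks. A single crossing cannot return to its copy, and two
  crossing blocks share two points, hence coincide.
\<close>

lemma cycle_free_4:
  assumes "cycle_free 4 (with_proj G)" "k < 4"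
  shows "cycle_free 4 (with_proj R)"
  unfolding R.cycle_free_4_iff
proof (intro notI, elim exE conjE)
  fix a b c d assume dist: "distinct [a, b, c, d]"
    and "{(a, b), (b, c), (c, d), (d, a)} \<subseteq> parcs R"
  then have arcs: "(a, b) \<in> parcs R" "(b, c) \<in> parcs R" "(c, d) \<in> parcs R" "(d, a) \<in> parcs R"
    by auto
  note facts = arcs[THEN arc_cases(1)] arcs[THEN arc_cases(3)]
  \<comment> \<open>Each arc keeps the point or the block, which gives 16 cases. A mixed pattern
    with one run of each kind contradicts \<open>flag_eq\<close> at the common ends of the runs; the
    alternating pattern contradicts \<open>two_points\<close>.\<close>
  have "pt a = pt b \<and> pt b = pt c \<and> pt c = pt d \<or> bl a = bl b \<and> bl b = bl c \<and> bl c = bl d"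
    using facts(5-8) dist[simplified] facts(1-4)
    by (elim disjE; metis two_points flag_eq)
  then consider "pt a = pt b" "pt b = pt c" "pt c = pt d" | "bl a = bl b" "bl b = bl c" "bl c = bl d"
    by blast
  then show False
  proof cases
    case 1
    then have "{(lb a, lb b), (lb b, lb c), (lb c, lb d), (lb d, lb a)} \<subseteq> parcs G"
      using arcs[THEN arc_cases(4)] by auto
    moreover have "distinct [lb a, lb b, lb c, lb d]"
      using 1 dist lab_eq facts(1-4) by auto
    ultimately show False
      using assms(1) unfolding G.cycle_free_4_iff by (elim notE) (intro exI conjI)
  next
    case 2
    then show False
      using length_same_block[OF dist, of "bl a"] facts(1-4) assms(2) by auto
  qed
qed

lemma cycle_free_5:
  assumes "cycle_free 5 (with_proj G)" "k < 5"
  shows "cycle_free 5 (with_proj R)"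
  unfolding R.cycle_free_5_iff
proof (intro notI, elim exE conjE)
  fix a b c d e assume dist: "distinct [a, b, c, d, e]"
    and "{(a, b), (b, c), (c, d), (d, e), (e, a)} \<subseteq> parcs R"
  then have arcs: "(a, b) \<in> parcs R" "(b, c) \<in> parcs R" "(c, d) \<in> parcs R" "(d, e) \<in> parcs R"
    "(e, a) \<in> parcs R"
    by auto
  note facts = arcs[THEN arc_cases(1)] arcs[THEN arc_cases(3)]
  \<comment> \<open>Five arcs still allow at most two runs of each kind, so the same two facts
    settle all 32 cases.\<close>
  have "pt a = pt b \<and> pt b = pt c \<and> pt c = pt d \<and> pt d = pt e \<or>
      bl a = bl b \<and> bl b = bl c \<and> bl c = bl d \<and> bl d = bl e"
    using facts(6-10) dist[simplified] facts(1-5)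
    by (elim disjE; metis two_points flag_eq)
  then consider "pt a = pt b" "pt b = pt c" "pt c = pt d" "pt d = pt e"
    | "bl a = bl b" "bl b = bl c" "bl c = bl d" "bl d = bl e"
    by blast
  then show False
  proof cases
    case 1
    then have "{(lb a, lb b), (lb b, lb c), (lb c, lb d), (lb d, lb e), (lb e, lb a)} \<subseteq> parcs G"
      using arcs[THEN arc_cases(4)] by auto
    moreover have "distinct [lb a, lb b, lb c, lb d, lb e]"
      using 1 dist lab_eq facts(1-5) by auto
    ultimately show False
      using assms(1) unfolding G.cycle_free_5_iff by (elim notE) (intro exI conjI)
  next
    case 2
    then show False
      using length_same_block[OF dist, of "bl a"] facts(1-5) assms(2) by auto
  qed
qed

end

section \<open>The induction along the recursion\<close>

theorem theorem16:
  fixes k :: nat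
    and v :: "nat \<Rightarrow> nat"
    and H :: "nat \<Rightarrow> 'p hypergraph"
    and S :: "nat \<Rightarrow> 'a pair_pre_digraph"
  assumes "k \<in> {3, 4, 5}"
    and "v 1 = k\<^sup>2 - k + 1"
    and "\<And>j. j > 1 \<Longrightarrow> v j = k * (k - 1) * (\<Prod>i = 1..j - 1. v i) + 1"
    and "\<And>i. i \<ge> 1 \<Longrightarrow> steiner_system k (v i) (H i)"
    and "K\<^bsub>k\<^esub> (with_proj (S 1))"
    and "\<And>i. i \<ge> 1 \<Longrightarrow> is_Gamma (S i) (H i) (S (i + 1))"
  shows "(\<forall>t \<ge> 1.
            pair_graph (S t) \<and>
            connected (with_proj (S t)) \<and>
            card (pverts (S t)) = k * (\<Prod>i = 1..t - 1. v i) \<and>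
            constant_link (with_proj (S t)) (with_proj (copies t (complete_on {..<k - 1})))) \<and>
         (k = 3 \<longrightarrow> (\<forall>t \<ge> 1. cycle_free 4 (with_proj (S t)) \<and> cycle_free 5 (with_proj (S t)))) \<and>
         (k = 4 \<longrightarrow> (\<forall>t \<ge> 1. cycle_free 5 (with_proj (S t))))"
proof -
  have k: "k \<ge> 3"
    using assms(1) by auto
  \<comment> \<open>At \<open>j = 1\<close> the product is empty and the recursion yields the
    prescribed first value, so one formula serves every level.\<close>
  have v: "v j = k * (k - 1) * (\<Prod>i = 1..j - 1. v i) + 1" if "j \<ge> 1" for j
    using assms(2) assms(3)[of j] that
    by (cases "j = 1") (simp_all add: power2_eq_square diff_mult_distrib2)
  have S1: "finite (pverts (S 1))" "card (pverts (S 1)) = k"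
    "parcs (S 1) = {(u, w). u \<in> pverts (S 1) \<and> w \<in> pverts (S 1) \<and> u \<noteq> w}"
    using assms(5) by (auto simp: complete_digraph_pair_def)
  have gamma: "\<exists>pt lb bl. gamma_graph (S t) (H t) (S (Suc t)) k (v t) pt lb bl"
    if t: "t \<ge> 1" "pair_graph (S t)" "card (pverts (S t)) = k * (\<Prod>i = 1..t - 1. v i)" for t
  proof (rule is_Gamma_imp_gamma_graph)
    show "steiner_system k (v t) (H t)" "is_Gamma (S t) (H t) (S (Suc t))"
      using assms(4,6) t(1) by simp_all
    \<comment> \<open>Here the choice of \<open>v t\<close> matters: \<open>v t - 1\<close> is
      \<open>k - 1\<close> times the order of \<open>S t\<close>, and cancelling the positive factor
      \<open>k - 1\<close> leaves degree equal to order.\<close>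
    show "card (incident (H t) x) = card (pverts (S t))" if "x \<in> points (H t)" for x
    proof -
      have "card (incident (H t) x) * (k - 1) = card (pverts (S t)) * (k - 1)"
        using steiner_system_degree[OF assms(4)[OF t(1)] that] k v[OF t(1)] t(3)
        by (simp add: mult_ac)
      then show ?thesis
        using k by simp
    qed
  qed (use k t in auto)
  \<comment> \<open>The link is carried as a colouring at each vertex, and the cycle conditions are
    stated by bounds on \<open>k\<close>, so one induction covers all three values of
    \<open>k\<close>.\<close>
  have main: "pair_graph (S t) \<and> connected (with_proj (S t)) \<and>
      card (pverts (S t)) = k * (\<Prod>i = 1..t - 1. v i) \<and>
      (\<forall>u \<in> pverts (S t). \<exists>c. clique_colouring (S t) {w. (u, w) \<in> parcs (S t)} t (k - 1) c) \<and>
      (k < 4 \<longrightarrow> cycle_free 4 (with_proj (S t))) \<and> (k < 5 \<longrightarrow> cycle_free 5 (with_proj (S t)))"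
    if "t \<ge> 1" for t
    using that
  proof (induction t rule: dec_induct)
    case base
    interpret pair_graph "S 1"
      using assms(5) by (rule pair_graphI_complete)
    have "pverts (S 1) \<noteq> {}"
      using S1 k by auto
    then have "connected (with_proj (S 1))"
      unfolding connected_iff using S1(3) by (auto intro: r_into_rtrancl)
    moreover have "\<exists>c. clique_colouring (S 1) {w. (u, w) \<in> parcs (S 1)} 1 (k - 1) c"
      if "u \<in> pverts (S 1)" for u
    proof -
      have "{w. (u, w) \<in> parcs (S 1)} = pverts (S 1) - {u}"
        using that S1(3) by auto
      moreover have "{w \<in> pverts (S 1) - {u}. True} = pverts (S 1) - {u}"
        by blast
      \<comment> \<open>In a complete graph the whole neighbourhood is a single clique, so colour 0
        suffices.\<close>
      ultimately have "clique_colouring (S 1) {w. (u, w) \<in> parcs (S 1)} 1 (k - 1) (\<lambda>_. 0)"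
        using that S1 by (simp add: clique_colouring_def image_subset_iff)
      then show ?thesis
        by blast
    qed
    ultimately show ?case
      using pair_graph S1(2) cycle_free_complete[OF assms(5)] by simp
  next
    case (step t)
    then obtain pt lb bl where "gamma_graph (S t) (H t) (S (Suc t)) k (v t) pt lb bl"
      using gamma by blast
    then interpret gamma_graph "S t" "H t" "S (Suc t)" k "v t" pt lb bl .
    have "v t > 0"
      using v step by simp
    have "card (pverts (S (Suc t))) = k * (\<Prod>i = 1..Suc t - 1. v i)"
      \<comment> \<open>The product for \<open>S t\<close> stops at \<open>t - 1\<close>; passing to
        \<open>Suc t\<close> adds exactly the factor \<open>v t\<close>, which the case split on
        \<open>t\<close> exposes.\<close>
      using step card_pverts by (cases t) (simp_all add: mult_ac)
    moreover have "\<exists>c. clique_colouring (S (Suc t)) {w. (u, w) \<in> parcs (S (Suc t))} (Suc t) (k - 1) c"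
      if "u \<in> pverts (S (Suc t))" for u
      using step lb_in[OF that] link_colouring[OF that] by blast
    ultimately show ?case
      using step pair_graph connected cycle_free_4 cycle_free_5 \<open>v t > 0\<close> by blast
  qed
  then have "constant_link (with_proj (S t)) (with_proj (copies t (complete_on {..<k - 1})))"
    if "t \<ge> 1" for t
    using that k by (intro pair_graph.constant_link_copiesI) auto
  then show ?thesis
    using main by simp
qed

end
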